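(* Let $l$ be a complete distributive lattice and $\Sigma$ a finite alphabet. A map $f:\Sigma^{\omega}\to l$ is of the form $L_\omega(\mathcal A)$ for some $l$-valued deterministic Rabin automaton $\mathcal A$ if and only if it is of the form $L_\omega(\mathcal B)$ for some $l$-valued Büchi automaton $\mathcal B$.
   Context: An $l$-valued Büchi automaton ($l$-VBA) is $\mathcal B=(Q,\Sigma,\delta,I,F)$ with finite $Q$, $\delta:Q\times\Sigma\times Q\to l$, $I,F:Q\to l$; for $w=\sigma_1\sigma_2\cdots$, $L_\omega(\mathcal B)(w)=\bigvee\{I(q_0)\wedge\bigwedge_{i\ge0}\delta(q_i,\sigma_{i+1},q_{i+1})\wedge\bigwedge_{j\in J}F(q_j): q_0,q_1,\ldots\in Q,\ J\subseteq\mathbb N\text{ infinite}\}$. An $l$-valued deterministic Rabin automaton ($l$-VDRA) is $\mathcal A=(Q,\Sigma,\delta,q_0,\mathcal F)$ with finite $Q$, $\delta:Q\times\Sigma\to Q$, $q_0\in Q$, $\mathcal F:2^Q\times2^Q\to l$. For $w=A_0A_1\cdots$ let $q_0q_1\cdots$ be its run, $q_{i+1}=\delta(q_i,A_i)$. Then $L_\omega(\mathcal A)(w)=\bigvee\{\mathcal F(H,K): (\exists n\,\forall m\ge n.\ q_m\notin H)\wedge(\forall n\,\exists m\ge n.\ q_m\in K)\}$. *)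

theory Defs
  imports Main "HOL-Library.Omega_Words_Fun"
begin

unbundle lattice_syntax

text \<open>
  The alphabet is a type \<open>'a\<close> (of class \<open>finite\<close> in the theorem) and the lattice of values is
  a type \<open>'l\<close>.  State sets are finite carrier sets; what the transition, initial and acceptance
  functions do outside the carrier is irrelevant.
\<close>

record ('q, 'a, 'l) vba =
  ba_states  :: "'q set"
  ba_trans   :: "'q \<Rightarrow> 'a \<Rightarrow> 'q \<Rightarrow> 'l"
  ba_initial :: "'q \<Rightarrow> 'l"
  ba_final   :: "'q \<Rightarrow> 'l"

definition is_vba :: "('q, 'a, 'l) vba \<Rightarrow> bool" where
  "is_vba B \<longleftrightarrow> finite (ba_states B)"

text \<open>Words are indexed from \<open>0\<close>, so \<open>w i\<close> is the letter \<open>\<sigma>\<^sub>i\<^sub>+\<^sub>1\<close> read between \<open>q i\<close> and \<open>q (i + 1)\<close>.\<close>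

definition vba_language :: "('q, 'a, 'l::complete_lattice) vba \<Rightarrow> 'a word \<Rightarrow> 'l" where
  "vba_language B w =
     Sup {ba_initial B (q 0)
            \<sqinter> (INF i. ba_trans B (q i) (w i) (q (Suc i)))
            \<sqinter> (INF j\<in>J. ba_final B (q j)) | q J.
          (\<forall>i. q i \<in> ba_states B) \<and> infinite (J :: nat set)}"

record ('q, 'a, 'l) vdra =
  ra_states :: "'q set"
  ra_trans  :: "'q \<Rightarrow> 'a \<Rightarrow> 'q"
  ra_start  :: "'q"
  ra_accept :: "'q set \<Rightarrow> 'q set \<Rightarrow> 'l"

definition is_vdra :: "('q, 'a, 'l) vdra \<Rightarrow> bool" where
  "is_vdra A \<longleftrightarrow> finite (ra_states A) \<and> ra_start A \<in> ra_states A \<and>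
     (\<forall>q\<in>ra_states A. \<forall>a. ra_trans A q a \<in> ra_states A)"

primrec vdra_run :: "('q, 'a, 'l) vdra \<Rightarrow> 'a word \<Rightarrow> nat \<Rightarrow> 'q" where
  "vdra_run A w 0 = ra_start A"
| "vdra_run A w (Suc i) = ra_trans A (vdra_run A w i) (w i)"

definition vdra_language :: "('q, 'a, 'l::complete_lattice) vdra \<Rightarrow> 'a word \<Rightarrow> 'l" where
  "vdra_language A w =
     Sup {ra_accept A H K | H K.
          H \<subseteq> ra_states A \<and> K \<subseteq> ra_states A \<and>
          (\<exists>n. \<forall>m\<ge>n. vdra_run A w m \<notin> H) \<and>
          (\<forall>n. \<exists>m\<ge>n. vdra_run A w m \<in> K)}"

text \<open>
  HOL cannot quantify existentially over the type of states.  Since state sets are finite,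
  natural numbers suffice as states: the next two lemmas reduce any other state type to them.
\<close>

definition vba_recognizable :: "('a word \<Rightarrow> 'l::complete_lattice) \<Rightarrow> bool" where
  "vba_recognizable f \<longleftrightarrow> (\<exists>B :: (nat, 'a, 'l) vba. is_vba B \<and> f = vba_language B)"

definition vdra_recognizable :: "('a word \<Rightarrow> 'l::complete_lattice) \<Rightarrow> bool" where
  "vdra_recognizable f \<longleftrightarrow> (\<exists>A :: (nat, 'a, 'l) vdra. is_vdra A \<and> f = vdra_language A)"

lemma vba_recognizable_any_state_type:
  fixes B :: "('q, 'a, 'l::complete_lattice) vba"
  assumes "is_vba B"
  shows "vba_recognizable (vba_language B)"
proof -
  from assms have "finite (ba_states B)" by (simp add: is_vba_def)
  then obtain h :: "'q \<Rightarrow> nat" where h: "inj_on h (ba_states B)"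
    using finite_imp_inj_to_nat_seg by blast
  define g where "g = inv_into (ba_states B) h"
  have gh: "g (h x) = x" if "x \<in> ba_states B" for x
    using h that by (simp add: g_def)
  define B' :: "(nat, 'a, 'l) vba" where
    "B' = \<lparr>ba_states = h ` ba_states B, ba_trans = (\<lambda>p a r. ba_trans B (g p) a (g r)),
           ba_initial = (\<lambda>p. ba_initial B (g p)), ba_final = (\<lambda>p. ba_final B (g p))\<rparr>"
  define val where "val w q J = ba_initial B (q 0)
      \<sqinter> (INF i. ba_trans B (q i) (w i) (q (Suc i))) \<sqinter> (INF j\<in>J. ba_final B (q j))"
    for w and q :: "nat \<Rightarrow> 'q" and J :: "nat set"
  have "vba_language B' w = vba_language B w" for w
  proof -
    have "{val w (\<lambda>i. g (p i)) J | p J. (\<forall>i. p i \<in> h ` ba_states B) \<and> infinite J}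
        = {val w q J | q J. (\<forall>i. q i \<in> ba_states B) \<and> infinite J}" (is "?L = ?R")
    proof
      show "?L \<subseteq> ?R"
      proof
        fix v assume "v \<in> ?L"
        then obtain p J where v: "v = val w (\<lambda>i. g (p i)) J" and J: "infinite J"
          and p: "\<forall>i. p i \<in> h ` ba_states B" by blast
        from p gh have "\<forall>i. g (p i) \<in> ba_states B" by (metis imageE)
        with v J show "v \<in> ?R" by blast
      qed
      show "?R \<subseteq> ?L"
      proof
        fix v assume "v \<in> ?R"
        then obtain q J where v: "v = val w q J" and J: "infinite J"
          and q: "\<forall>i. q i \<in> ba_states B" by blast
        from q gh have "(\<lambda>i. g (h (q i))) = q" by auto
        with v have "v = val w (\<lambda>i. g (h (q i))) J" by simp
        with q J show "v \<in> ?L"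
          by (intro CollectI exI[of _ "\<lambda>i. h (q i)"] exI[of _ J]) auto
      qed
    qed
    then show ?thesis
      by (simp add: vba_language_def B'_def val_def)
  qed
  moreover have "is_vba B'" using assms by (simp add: is_vba_def B'_def)
  ultimately show ?thesis
    unfolding vba_recognizable_def by (metis ext)
qed

lemma vdra_recognizable_any_state_type:
  fixes A :: "('q, 'a, 'l::complete_lattice) vdra"
  assumes A: "is_vdra A"
  shows "vdra_recognizable (vdra_language A)"
proof -
  let ?Q = "ra_states A"
  from A have "finite ?Q" by (simp add: is_vdra_def)
  then obtain h :: "'q \<Rightarrow> nat" where h: "inj_on h ?Q"
    using finite_imp_inj_to_nat_seg by blast
  define g where "g = inv_into ?Q h"
  have gh: "g (h x) = x" if "x \<in> ?Q" for x
    using h that by (simp add: g_def)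
  define A' :: "(nat, 'a, 'l) vdra" where
    "A' = \<lparr>ra_states = h ` ?Q, ra_trans = (\<lambda>p a. h (ra_trans A (g p) a)),
           ra_start = h (ra_start A), ra_accept = (\<lambda>H K. ra_accept A (g ` H) (g ` K))\<rparr>"
  have run: "vdra_run A w i \<in> ?Q" for w i
    using A by (induction i) (auto simp: is_vdra_def)
  have run': "vdra_run A' w i = h (vdra_run A w i)" for w i
    by (induction i) (use gh run in \<open>auto simp: A'_def\<close>)
  have ghS: "g ` h ` S = S" if "S \<subseteq> ?Q" for S
    using that gh by (force simp: image_iff)
  have mem: "h x \<in> h ` S \<longleftrightarrow> x \<in> S" if "S \<subseteq> ?Q" "x \<in> ?Q" for x S
    using that h by (meson inj_on_image_mem_iff)
  have "vdra_language A' w = vdra_language A w" for w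
  proof -
    have "{ra_accept A (g ` H) (g ` K) | H K. H \<subseteq> h ` ?Q \<and> K \<subseteq> h ` ?Q \<and>
            (\<exists>n. \<forall>m\<ge>n. h (vdra_run A w m) \<notin> H) \<and> (\<forall>n. \<exists>m\<ge>n. h (vdra_run A w m) \<in> K)}
        = {ra_accept A H K | H K. H \<subseteq> ?Q \<and> K \<subseteq> ?Q \<and>
            (\<exists>n. \<forall>m\<ge>n. vdra_run A w m \<notin> H) \<and> (\<forall>n. \<exists>m\<ge>n. vdra_run A w m \<in> K)}"
      (is "?L = ?R")
    proof
      show "?L \<subseteq> ?R"
      proof
        fix v assume "v \<in> ?L"
        then obtain H' K' where v: "v = ra_accept A (g ` H') (g ` K')"
          and sub: "H' \<subseteq> h ` ?Q" "K' \<subseteq> h ` ?Q"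
          and acc: "\<exists>n. \<forall>m\<ge>n. h (vdra_run A w m) \<notin> H'"
            "\<forall>n. \<exists>m\<ge>n. h (vdra_run A w m) \<in> K'" by blast
        from sub obtain H K where HK: "H \<subseteq> ?Q" "K \<subseteq> ?Q" "H' = h ` H" "K' = h ` K"
          by (meson subset_imageE)
        from acc HK run have "\<exists>n. \<forall>m\<ge>n. vdra_run A w m \<notin> H"
          "\<forall>n. \<exists>m\<ge>n. vdra_run A w m \<in> K" by (auto simp: mem)
        with v HK show "v \<in> ?R" by (auto simp: ghS)
      qed
      show "?R \<subseteq> ?L"
      proof
        fix v assume "v \<in> ?R"
        then obtain H K where v: "v = ra_accept A H K"
          and sub: "H \<subseteq> ?Q" "K \<subseteq> ?Q"
          and acc: "\<exists>n. \<forall>m\<ge>n. vdra_run A w m \<notin> H"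
            "\<forall>n. \<exists>m\<ge>n. vdra_run A w m \<in> K" by blast
        have "v = ra_accept A (g ` h ` H) (g ` h ` K)" using v sub by (simp add: ghS)
        moreover have "\<exists>n. \<forall>m\<ge>n. h (vdra_run A w m) \<notin> h ` H"
          "\<forall>n. \<exists>m\<ge>n. h (vdra_run A w m) \<in> h ` K" using acc sub run by (simp_all add: mem)
        ultimately show "v \<in> ?L" using sub
          by (intro CollectI exI[of _ "h ` H"] exI[of _ "h ` K"]) auto
      qed
    qed
    then show ?thesis
      unfolding vdra_language_def run' by (simp add: A'_def)
  qed
  moreover have "is_vdra A'"
    using A gh by (auto simp: is_vdra_def A'_def)
  ultimately show ?thesis
    unfolding vdra_recognizable_def by (metis ext)
qed

end

theory Submission
  imports Defs "HOL-Library.Ramsey"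
begin

(* HOL-Library.FuncSet and Omega_Words_Fun both use the arrow in "w [i \<rightarrow> j]". *)
unbundle no funcset_syntax

text \<open>
  From Buchi to Rabin.  Map a finite word to its profile, i.e. the set of all \<open>(p, D, r)\<close> such that
  some path from \<open>p\<close> to \<open>r\<close> reads the word and uses exactly the transitions in \<open>D\<close>.  This is a
  morphism \<open>h\<close> into a finite semigroup, and if two infinite words factorize with the same
  profiles block by block, then runs can be transferred between them without changing the initial
  state, the transitions used or the states visited infinitely often.  Hence the language \<open>L\<close> is
  constant on each set \<open>X\<^sub>s X\<^sub>e\<^sup>\<omega>\<close>, where \<open>X\<^sub>c\<close> is the set of words of value \<open>c\<close>; only this is used.

  Consider idempotents \<open>e\<close> with \<open>s e = s\<close>.  A word has an \<open>(s, e)\<close>-event at \<open>j\<close> if its prefix of length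
  \<open>j\<close> lies in \<open>X\<^sub>s P\<^sub>e\<close>, where \<open>P\<^sub>e\<close> consists of the words of \<open>X\<^sub>e\<close> without proper prefix in \<open>X\<^sub>e\<close>.
  A deterministic automaton can detect events.  Infinitely many \<open>(s, e)\<close>-events imply, by Ramsey's
  theorem, \<open>w \<in> X\<^sub>s X\<^sub>f\<^sup>\<omega>\<close> for some idempotent \<open>f\<close> in the right ideal of \<open>e\<close>.  Conversely \<open>w \<in> X\<^sub>s X\<^sub>f\<^sup>\<omega>\<close>
  implies infinitely many \<open>(s, f)\<close>-events.  So if \<open>(s, e)\<close>-events recur, and \<open>(s, f)\<close>-events occur only
  finitely often whenever \<open>f\<close> generates a strictly smaller right ideal than \<open>e\<close>, then \<open>e\<close> and \<open>f\<close>
  generate the same right ideal, \<open>X\<^sub>s X\<^sub>e\<^sup>\<omega>\<close> and \<open>X\<^sub>s X\<^sub>f\<^sup>\<omega>\<close> intersect, and \<open>L w\<close> is the constant value of \<open>L\<close> on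
  \<open>X\<^sub>s X\<^sub>e\<^sup>\<omega>\<close>.  This is a Rabin condition, and a minimal right ideal gives a pair satisfying it.

  From Rabin to Buchi, guess the pair \<open>(H, K)\<close> and a position after which \<open>H\<close> is avoided.
\<close>

section \<open>Infinite words: periodicity and cutting into factors\<close>

lemma iter_unique:
  assumes v: "v \<noteq> []" and x: "x = v \<frown> x"
  shows "x = v\<^sup>\<omega>"
proof
  fix n
  show "x n = v\<^sup>\<omega> n"
  proof (induction n rule: less_induct)
    case (less n)
    show ?case
    proof (cases "n < length v")
      case True
      then have "x n = v ! n" using fun_cong[OF x, of n] by (metis conc_fst)
      then show ?thesis using True v by simp
    next
      case False
      then have "x n = x (n - length v)" using fun_cong[OF x, of n] by (metis conc_snd)
      also have "\<dots> = v\<^sup>\<omega> (n - length v)" 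
        using less.IH[of "n - length v"] diff_less[of "length v" n] False v
        by (cases "n = 0") simp_all
      also have "\<dots> = v\<^sup>\<omega> n" using False v by (simp add: mod_if)
      finally show ?thesis .
    qed
  qed
qed

text \<open>The right-hand side is a fixed point of prefixing \<open>b @ a\<close>, and
  \<open>iter_unique\<close> admits only one.\<close>

lemma iter_rotate:
  assumes "a @ b \<noteq> []"
  shows "(b @ a)\<^sup>\<omega> = b \<frown> (a @ b)\<^sup>\<omega>"
proof -
  have "b \<frown> (a @ b)\<^sup>\<omega> = b \<frown> (a @ b) \<frown> (a @ b)\<^sup>\<omega>"
    using assms iter_unroll[of "a @ b"] by (metis length_greater_0_conv)
  also have "\<dots> = (b @ a) \<frown> b \<frown> (a @ b)\<^sup>\<omega>"
    by (simp only: conc_conc append_assoc)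
  finally have "b \<frown> (a @ b)\<^sup>\<omega> = (b @ a)\<^sup>\<omega>"
    using assms by (intro iter_unique) blast+
  then show ?thesis by (rule sym)
qed

lemma subsequence_join:
  assumes "i \<le> j" "j \<le> k"
  shows "w [i \<rightarrow> k] = w [i \<rightarrow> j] @ w [j \<rightarrow> k]"
proof -
  have "[i..<k] = [i..<j] @ [j..<k]"
    using upt_add_eq_append[OF assms(1), of "k - j"] assms by simp
  then show ?thesis by (simp add: subsequence_def)
qed

section \<open>Factorizations and morphisms into a finite semigroup\<close>

locale finite_word_hom =
  fixes mult :: "'s \<Rightarrow> 's \<Rightarrow> 's" (infixl "\<odot>" 70)
    and h :: "'a list \<Rightarrow> 's"
  assumes assoc: "(x \<odot> y) \<odot> z = x \<odot> (y \<odot> z)"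
    and hom: "h (u @ v) = h u \<odot> h v"
    and fin: "finite (range h)"
begin

definition factorizes :: "'s \<Rightarrow> 's \<Rightarrow> 'a word \<Rightarrow> bool" where
  "factorizes s e w \<longleftrightarrow> (\<exists>g. idx_sequence g \<and> h (w [g 0 \<rightarrow> g 1]) = s \<and>
     (\<forall>n. h (w [g (Suc n) \<rightarrow> g (Suc (Suc n))]) = e))"

definition right_ideal :: "'s \<Rightarrow> 's set" where
  "right_ideal e = (\<lambda>x. e \<odot> x) ` range h"

definition linked :: "'s \<Rightarrow> 's \<Rightarrow> bool" where
  "linked s e \<longleftrightarrow> s \<odot> e = s \<and> e \<odot> e = e"

text \<open>
  The value \<open>e\<close> is attained at the end of a factor \<open>w [i \<rightarrow> j]\<close> for the first time.  Minimality
  makes \<open>j\<close> a function of \<open>i\<close>, so infinitely many events start at infinitely many positions.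
\<close>

definition first_hit :: "'s \<Rightarrow> 's \<Rightarrow> 'a word \<Rightarrow> nat \<Rightarrow> nat \<Rightarrow> bool" where
  "first_hit s e w i j \<longleftrightarrow> i \<le> j \<and> h (w [0 \<rightarrow> i]) = s \<and> h (w [i \<rightarrow> j]) = e \<and>
     (\<forall>k\<in>{i..<j}. h (w [i \<rightarrow> k]) \<noteq> e)"

definition event :: "'s \<Rightarrow> 's \<Rightarrow> 'a word \<Rightarrow> nat \<Rightarrow> bool" where
  "event s e w j \<longleftrightarrow> (\<exists>i. first_hit s e w i j)"

lemma hom_join:
  assumes "i \<le> j" "j \<le> k"
  shows "h (w [i \<rightarrow> k]) = h (w [i \<rightarrow> j]) \<odot> h (w [j \<rightarrow> k])"
  by (simp add: subsequence_join[OF assms] hom)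

lemma factorizes_conc_iter:
  assumes "u \<noteq> []" "v \<noteq> []"
  shows "factorizes (h u) (h v) (u \<frown> v\<^sup>\<omega>)"
proof -
  define g where "g n = (case n of 0 \<Rightarrow> 0 | Suc m \<Rightarrow> length u + m * length v)" for n
  have "(u \<frown> v\<^sup>\<omega>) [length u + n * length v \<rightarrow> length u + Suc n * length v] = v" for n
    using assms by (intro nth_equalityI) auto
  moreover have "idx_sequence g"
    using assms by (auto simp: idx_sequence_def g_def split: nat.split)
  ultimately show ?thesis
    unfolding factorizes_def by (intro exI[of _ g]) (simp add: g_def)
qed

lemma factorizes_blocks:
  assumes "factorizes s e w"
  obtains u v where "u \<noteq> []" "v \<noteq> []" "h u = s" "h v = e"
proof -
  obtain g where g: "idx_sequence g" "h (w [g 0 \<rightarrow> g 1]) = s" "h (w [g 1 \<rightarrow> g 2]) = e"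
    using assms unfolding factorizes_def by (metis One_nat_def Suc_1)
  from g(1) have "g 0 < g 1" "g 1 < g 2"
    unfolding idx_sequence_def by (metis One_nat_def Suc_1)+
  with g show ?thesis
    by (intro that[of "w [g 0 \<rightarrow> g 1]" "w [g 1 \<rightarrow> g 2]"]) auto
qed

lemma ramsey_factor:
  assumes "infinite Z"
  obtains Y e where "Y \<subseteq> Z" "infinite Y" "\<And>i j. \<lbrakk>i \<in> Y; j \<in> Y; i < j\<rbrakk> \<Longrightarrow> h (w [i \<rightarrow> j]) = e"
proof -
  obtain idx :: "'s \<Rightarrow> nat" and n where idx: "idx ` range h = {i. i < n}" "inj_on idx (range h)"
    using finite_imp_inj_to_nat_seg[OF fin] by blast
  \<comment> \<open>A pair of positions is coloured by the value of the factor between them;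
    \<open>idx\<close> turns values into numeric colours.\<close>
  define c where "c X = idx (h (w [Min X \<rightarrow> Max X]))" for X
  have "c X < n" for X
    using idx(1) unfolding c_def by blast
  then obtain Y t where Y: "Y \<subseteq> Z" "infinite Y" and t: "\<forall>x\<in>Y. \<forall>y\<in>Y. x \<noteq> y \<longrightarrow> c {x, y} = t"
    using Ramsey2[OF assms, of c n] by blast
  have "h (w [i \<rightarrow> j]) = inv_into (range h) idx t" if "i \<in> Y" "j \<in> Y" "i < j" for i j
  proof -
    have "idx (h (w [i \<rightarrow> j])) = t"
      using t that by (fastforce simp: c_def)
    then show ?thesis using idx(2) by (metis inv_into_f_f rangeI)
  qed
  with Y that show ?thesis by blast
qed

text \<open>Cutting a homogeneous factor, or a prefix, at an intermediate element of
  \<open>Y\<close> gives \<open>f \<odot> f = f\<close> and \<open>s \<odot> f = s\<close>.\<close>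

lemma ramsey_linked:
  assumes Z: "infinite Z" and s: "\<And>i. i \<in> Z \<Longrightarrow> h (w [0 \<rightarrow> i]) = s"
  obtains Y f where "Y \<subseteq> Z" "infinite Y" "linked s f" "factorizes s f w"
    "\<And>i j. \<lbrakk>i \<in> Y; j \<in> Y; i < j\<rbrakk> \<Longrightarrow> h (w [i \<rightarrow> j]) = f"
proof -
  \<comment> \<open>Position \<open>0\<close> is prepended to the enumeration of \<open>Y\<close> as
    the first cut, so it must not lie in \<open>Y\<close>.\<close>
  have Z0: "infinite (Z - {0})" using Z by simp
  obtain Y f where Y: "Y \<subseteq> Z - {0}" "infinite Y"
    and f: "\<And>i j. \<lbrakk>i \<in> Y; j \<in> Y; i < j\<rbrakk> \<Longrightarrow> h (w [i \<rightarrow> j]) = f"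
    by (rule ramsey_factor[OF Z0, of w]) (rule that)
  let ?y = "enumerate Y"
  have y: "?y n \<in> Y" "?y n < ?y (Suc n)" for n
    using Y(2) by (auto simp: enumerate_in_set)
  have pre: "h (w [0 \<rightarrow> ?y n]) = s" for n
    using y(1) Y(1) s by blast
  have "s \<odot> f = s"
    using hom_join[of 0 "?y 0" "?y (Suc 0)" w] pre f[OF y(1) y(1) y(2)] y(2)[of 0] by simp
  moreover have "f \<odot> f = f"
  proof -
    have less: "?y 0 < ?y (Suc 0)" "?y (Suc 0) < ?y (Suc (Suc 0))" by (rule y(2))+
    then show ?thesis
      using hom_join[of "?y 0" "?y (Suc 0)" "?y (Suc (Suc 0))" w]
        f[OF y(1) y(1) less(1)] f[OF y(1) y(1) less(2)] f[OF y(1) y(1) less_trans[OF less]]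
      by simp
  qed
  moreover have "factorizes s f w"
    unfolding factorizes_def
  proof (intro exI conjI allI)
    have "0 < ?y 0" using y(1)[of 0] Y(1) by auto
    then show "idx_sequence (case_nat 0 ?y)"
      using y(2) by (auto simp: idx_sequence_def split: nat.split)
  qed (use pre f y in auto)
  ultimately have "linked s f" "factorizes s f w"
    by (simp_all add: linked_def)
  moreover have "Y \<subseteq> Z" using Y(1) by blast
  ultimately show ?thesis
    using that Y(2) f by presburger
qed

text \<open>Since \<open>s\<close> absorbs \<open>e\<close>, every prefix ending at a positive cut
  has value \<open>s\<close>; the next block ensures that \<open>e\<close> is hit after it.\<close>

lemma factorizes_event:
  assumes "factorizes s e w" "s \<odot> e = s"
  shows "\<exists>\<^sub>\<infinity>j. event s e w j"
  unfolding INFM_nat_le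
proof
  fix m
  obtain g where g: "idx_sequence g" "h (w [g 0 \<rightarrow> g 1]) = s"
    "\<And>n. h (w [g (Suc n) \<rightarrow> g (Suc (Suc n))]) = e"
    using assms(1) unfolding factorizes_def by blast
  have g0: "g 0 = 0" and less: "\<And>n. g n < g (Suc n)"
    using g(1) by (auto simp: idx_sequence_def)
  have s: "h (w [0 \<rightarrow> g (Suc n)]) = s" for n
  proof (induction n)
    case 0
    then show ?case using g(2) g0 by simp
  next
    case (Suc n)
    then show ?case
      using hom_join[of 0 "g (Suc n)" "g (Suc (Suc n))" w] g(3) less assms(2) by (simp add: less_imp_le)
  qed
  have ge: "n \<le> g n" for n
    by (metis strict_mono_Suc_iff strict_mono_imp_increasing less)
  define i where "i = g (Suc m)"
  define j where "j = (LEAST j. i \<le> j \<and> h (w [i \<rightarrow> j]) = e)"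
  have "i \<le> g (Suc (Suc m)) \<and> h (w [i \<rightarrow> g (Suc (Suc m))]) = e"
    using g(3) less by (simp add: i_def less_imp_le)
  then have j: "i \<le> j" "h (w [i \<rightarrow> j]) = e"
    unfolding j_def by (metis (mono_tags, lifting) LeastI)+
  moreover have "\<not> (i \<le> k \<and> h (w [i \<rightarrow> k]) = e)" if "k < j" for k
    using that not_less_Least unfolding j_def by blast
  ultimately have "first_hit s e w i j"
    unfolding first_hit_def using s[of m] by (force simp: i_def)
  moreover have "m \<le> j" using j(1) ge[of "Suc m"] i_def by linarith
  ultimately show "\<exists>j\<ge>m. event s e w j"
    unfolding event_def by blast
qed

lemma event_factorizes:
  assumes "\<exists>\<^sub>\<infinity>j. event s e w j"
  obtains f where "f \<in> right_ideal e" "linked s f" "factorizes s f w"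
proof -
  define I where "I = {i. \<exists>j. first_hit s e w i j}"
  define J where "J i = (THE j. first_hit s e w i j)" for i
  have J: "J i = j" if "first_hit s e w i j" for i j
  proof -
    have "k = j" if "first_hit s e w i k" for k
      using that \<open>first_hit s e w i j\<close> unfolding first_hit_def
      by (cases k j rule: linorder_cases) auto
    with that show ?thesis unfolding J_def by blast
  qed
  have "{j. event s e w j} \<subseteq> J ` I"
    using J unfolding event_def I_def by force
  moreover have "infinite {j. event s e w j}"
    using assms unfolding frequently_cofinite .
  ultimately have I: "infinite I"
    using finite_surj by blast
  have s: "h (w [0 \<rightarrow> i]) = s" if "i \<in> I" for i
    using that by (auto simp: I_def first_hit_def)
  obtain Y f where Y: "Y \<subseteq> I" "infinite Y" and f: "linked s f" "factorizes s f w"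
    and Yf: "\<And>i j. \<lbrakk>i \<in> Y; j \<in> Y; i < j\<rbrakk> \<Longrightarrow> h (w [i \<rightarrow> j]) = f"
    by (rule ramsey_linked[of I w s, OF I s]) (assumption, rule that)
  obtain i where i: "i \<in> Y" using Y(2) by fastforce
  then obtain j where j: "first_hit s e w i j" using Y(1) by (auto simp: I_def)
  obtain k where k: "k \<in> Y" "j < k" using Y(2) by (meson infinite_nat_iff_unbounded)
  have "f = e \<odot> h (w [j \<rightarrow> k])"
    using hom_join[of i j k w] Yf[of i k] i j k by (auto simp: first_hit_def)
  then have "f \<in> right_ideal e" by (auto simp: right_ideal_def)
  with f that show ?thesis by blast
qed

text \<open>
  If \<open>b\<close> and \<open>a\<close> are words with values \<open>f\<close> and \<open>e\<close>, then \<open>b a\<close> has value \<open>f e = e\<close> and \<open>a b\<close> has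
  value \<open>e f = f\<close>, so the word \<open>(b a)\<^sup>\<omega> = b (a b)\<^sup>\<omega>\<close> factorizes both ways.
\<close>

lemma common_factorization:
  assumes lin: "linked s e" "linked s f"
    and ideal: "f \<in> right_ideal e" "e \<in> right_ideal f"
    and w: "factorizes s f w"
  obtains w' where "factorizes s e w'" "factorizes s f w'"
proof -
  obtain x y where x: "f = e \<odot> h x" and y: "e = f \<odot> h y"
    using ideal by (auto simp: right_ideal_def)
  obtain u b where u: "u \<noteq> []" "h u = s" and b: "b \<noteq> []" "h b = f"
    using factorizes_blocks[OF w] by blast
  define a where "a = b @ y"
  have a: "h a = e" by (simp add: a_def hom b y)
  have "e \<odot> f = f" "f \<odot> e = e"
    using x y lin by (metis assoc linked_def)+
  then have "h (b @ a) = e" "h (a @ b) = f" "h (u @ b) = s"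
    using lin by (simp_all add: hom a b u linked_def)
  moreover have "factorizes (h u) (h (b @ a)) (u \<frown> (b @ a)\<^sup>\<omega>)"
    using u b by (intro factorizes_conc_iter) auto
  moreover have "factorizes (h (u @ b)) (h (a @ b)) ((u @ b) \<frown> (a @ b)\<^sup>\<omega>)"
    using u b by (intro factorizes_conc_iter) auto
  moreover have "(u @ b) \<frown> (a @ b)\<^sup>\<omega> = u \<frown> (b @ a)\<^sup>\<omega>"
    using iter_rotate[of a b] b by simp
  ultimately show ?thesis
    using u that by simp
qed

subsection \<open>The deterministic Rabin automaton of a saturated function\<close>

definition subset_states :: "('s \<times> ('s \<times> 's \<times> 's set) set) set" where
  "subset_states = range h \<times> Pow (range h \<times> range h \<times> Pow (range h))"

text \<open>The inserted triple opens a factor at the current position. \<open>G\<close> gathers the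
  earlier values of an open factor, so \<open>e \<notin> G\<close> tests that \<open>e\<close> is
  new.\<close>

fun subset_step ::
  "'s \<times> ('s \<times> 's \<times> 's set) set \<Rightarrow> 'a \<Rightarrow> 's \<times> ('s \<times> 's \<times> 's set) set" where
  "subset_step (c, T) a = (c \<odot> h [a],
     insert (c \<odot> h [a], h [], {}) ((\<lambda>(s, d, G). (s, d \<odot> h [a], insert d G)) ` T))"

definition event_state :: "'s \<Rightarrow> 's \<Rightarrow> 's \<times> ('s \<times> 's \<times> 's set) set \<Rightarrow> bool" where
  "event_state s e q \<longleftrightarrow> (\<exists>G. (s, e, G) \<in> snd q \<and> e \<notin> G)"

definition below :: "'s \<Rightarrow> 's \<Rightarrow> 's set" where
  "below s e = {f \<in> right_ideal e. linked s f \<and> e \<notin> right_ideal f}"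

definition avoid :: "'s \<Rightarrow> 's \<Rightarrow> ('s \<times> ('s \<times> 's \<times> 's set) set) set" where
  "avoid s e = {q \<in> subset_states. \<exists>f\<in>below s e. event_state s f q}"

definition recur :: "'s \<Rightarrow> 's \<Rightarrow> ('s \<times> ('s \<times> 's \<times> 's set) set) set" where
  "recur s e = {q \<in> subset_states. event_state s e q}"

text \<open>
  The state after a prefix \<open>u\<close> consists of \<open>h u\<close> and, for every factorization \<open>u = x y\<close>, the
  values of \<open>x\<close>, of \<open>y\<close> and of the proper prefixes of \<open>y\<close>.
\<close>

definition subset_automaton ::
  "('a word \<Rightarrow> 'l) \<Rightarrow> ('s \<times> ('s \<times> 's \<times> 's set) set, 'a, 'l::complete_lattice) vdra" where
  "subset_automaton f = \<lparr>ra_states = subset_states, ra_trans = subset_step,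
     ra_start = (h [], {(h [], h [], {})}),
     ra_accept = (\<lambda>H K. Sup {f w | w s e. linked s e \<and> factorizes s e w \<and>
       H = avoid s e \<and> K = recur s e})\<rparr>"

lemma is_vdra_subset_automaton: "is_vdra (subset_automaton f)"
proof -
  have "finite subset_states"
    using fin by (simp add: subset_states_def)
  moreover have "subset_step q a \<in> subset_states" if "q \<in> subset_states" for q a
    using that hom[of _ "[a]", symmetric]
    by (cases q) (fastforce simp: subset_states_def)
  ultimately show ?thesis
    by (auto simp: is_vdra_def subset_automaton_def subset_states_def)
qed

lemma subset_automaton_run:
  "vdra_run (subset_automaton f) w n =
     (h (w [0 \<rightarrow> n]), (\<lambda>i. (h (w [0 \<rightarrow> i]), h (w [i \<rightarrow> n]), (\<lambda>k. h (w [i \<rightarrow> k])) ` {i..<n})) ` {..n})"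
proof (induction n)
  case 0
  then show ?case by (simp add: subset_automaton_def)
next
  case (Suc n)
  have Suc_h: "h (w [i \<rightarrow> Suc n]) = h (w [i \<rightarrow> n]) \<odot> h [w n]" if "i \<le> n" for i
    using that by (simp add: hom)
  have "insert (h (w [i \<rightarrow> n])) ((\<lambda>k. h (w [i \<rightarrow> k])) ` {i..<n}) = (\<lambda>k. h (w [i \<rightarrow> k])) ` {i..<Suc n}"
    if "i \<le> n" for i
    using that by (simp add: atLeastLessThanSuc)
  then have "(\<lambda>(s, d, G). (s, d \<odot> h [w n], insert d G)) `
      (\<lambda>i. (h (w [0 \<rightarrow> i]), h (w [i \<rightarrow> n]), (\<lambda>k. h (w [i \<rightarrow> k])) ` {i..<n})) ` {..n} =
    (\<lambda>i. (h (w [0 \<rightarrow> i]), h (w [i \<rightarrow> Suc n]), (\<lambda>k. h (w [i \<rightarrow> k])) ` {i..<Suc n})) ` {..n}"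
    unfolding image_image by (intro image_cong refl) (simp only: Suc_h prod.case atMost_iff)
  then show ?case
    using Suc by (simp add: subset_automaton_def atMost_Suc Suc_h del: subseq_to_Suc)
qed

lemma event_state_run: "event_state s e (vdra_run (subset_automaton f) w n) \<longleftrightarrow> event s e w n"
proof -
  have "event_state s e (vdra_run (subset_automaton f) w n) \<longleftrightarrow>
    (\<exists>i\<le>n. h (w [0 \<rightarrow> i]) = s \<and> h (w [i \<rightarrow> n]) = e \<and> e \<notin> (\<lambda>k. h (w [i \<rightarrow> k])) ` {i..<n})"
    unfolding subset_automaton_run event_state_def snd_conv image_iff[of "(_, _)"] by blast
  also have "\<dots> \<longleftrightarrow> event s e w n"
  proof -
    have "e \<notin> (\<lambda>k. h (w [i \<rightarrow> k])) ` {i..<n} \<longleftrightarrow> (\<forall>k\<in>{i..<n}. h (w [i \<rightarrow> k]) \<noteq> e)" for i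
      by blast
    then show ?thesis by (simp only: event_def first_hit_def)
  qed
  finally show ?thesis .
qed

lemma vdra_run_subset_states: "vdra_run (subset_automaton f) w n \<in> subset_states"
proof -
  have "vdra_run A w n \<in> ra_states A" if "is_vdra A" for A :: "('q, 'a, 'v) vdra"
    using that by (induction n) (auto simp: is_vdra_def)
  from this[OF is_vdra_subset_automaton] show ?thesis
    by (simp add: subset_automaton_def)
qed

definition accepting_pair :: "'s \<Rightarrow> 's \<Rightarrow> 'a word \<Rightarrow> bool" where
  "accepting_pair s e w \<longleftrightarrow> linked s e \<and> (\<exists>\<^sub>\<infinity>j. event s e w j) \<and>
     (\<forall>\<^sub>\<infinity>j. \<forall>f\<in>below s e. \<not> event s f w j)"

lemma accepting_pair_run:
  "accepting_pair s e w \<longleftrightarrow> linked s e \<and>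
     (\<exists>n. \<forall>m\<ge>n. vdra_run (subset_automaton f) w m \<notin> avoid s e) \<and>
     (\<forall>n. \<exists>m\<ge>n. vdra_run (subset_automaton f) w m \<in> recur s e)"
  unfolding accepting_pair_def avoid_def recur_def INFM_nat_le MOST_nat_le
  by (auto simp: event_state_run vdra_run_subset_states)

lemma accepting_pair_equivalent:
  assumes acc: "accepting_pair s e w"
  obtains f w' where "factorizes s f w" "factorizes s f w'" "factorizes s e w'"
proof -
  have e: "linked s e" "\<exists>\<^sub>\<infinity>j. event s e w j"
    using acc by (simp_all add: accepting_pair_def)
  obtain f where f: "f \<in> right_ideal e" "linked s f" "factorizes s f w"
    by (rule event_factorizes[OF e(2)])
  have "\<exists>\<^sub>\<infinity>j. event s f w j"
    using f factorizes_event by (simp add: linked_def)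
  moreover have "\<forall>\<^sub>\<infinity>j. \<forall>f\<in>below s e. \<not> event s f w j"
    using acc by (simp add: accepting_pair_def)
  \<comment> \<open>Events of \<open>f\<close> recur, while those of \<open>below s e\<close> die
    out, so \<open>f\<close> cannot belong to that set.\<close>
  ultimately have "\<exists>\<^sub>\<infinity>j. event s f w j \<and> (\<forall>f\<in>below s e. \<not> event s f w j)"
    by (rule frequently_eventually_frequently)
  then have "f \<notin> below s e"
    by (blast dest: INFM_EX)
  with f have "e \<in> right_ideal f" by (simp add: below_def)
  then obtain w' where "factorizes s e w'" "factorizes s f w'"
    by (rule common_factorization[OF e(1) f(2,1) _ f(3)]) (rule that)
  with f that show ?thesis by blast
qed

text \<open>Pigeonhole fixes a recurring prefix value \<open>s\<close>. Among the idempotents linked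
  with \<open>s\<close> whose events recur, one with a right ideal of least cardinality
  works.\<close>

lemma accepting_pair_exists: "\<exists>s e. accepting_pair s e w"
proof -
  have "finite (range (\<lambda>i. h (w [0 \<rightarrow> i])))"
    using fin by (rule finite_subset[rotated]) blast
  then obtain s where Z: "infinite {i. h (w [0 \<rightarrow> i]) = s}"
    using pigeonhole_infinite[of UNIV "\<lambda>i. h (w [0 \<rightarrow> i])"] by auto
  obtain e0 where "linked s e0" "factorizes s e0 w"
    by (rule ramsey_linked[OF Z, of w s]) auto
  define E where "E = {e. linked s e \<and> (\<exists>\<^sub>\<infinity>j. event s e w j)}"
  have "e0 \<in> E"
    using \<open>linked s e0\<close> \<open>factorizes s e0 w\<close> factorizes_event by (simp add: E_def linked_def)
  then obtain e where e: "e \<in> E" and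
    min: "\<And>f. f \<in> E \<Longrightarrow> card (right_ideal e) \<le> card (right_ideal f)"
    using ex_has_least_nat[of "\<lambda>e. e \<in> E" e0 "\<lambda>e. card (right_ideal e)"] by blast
  have "f \<notin> E" if f: "f \<in> below s e" for f
  proof
    assume "f \<in> E"
    \<comment> \<open>This makes the inclusion of right ideals below strict, since \<open>e\<close>
      lies outside that of \<open>f\<close>.\<close>
    have "e \<in> right_ideal e"
    proof -
      obtain j where "event s e w j" using e unfolding E_def by (blast dest: INFM_EX)
      then have "e \<in> range h" by (auto simp: event_def first_hit_def)
      moreover have "e = e \<odot> e" using e by (simp add: E_def linked_def)
      ultimately show ?thesis unfolding right_ideal_def by (rule image_eqI[rotated])
    qed
    moreover obtain x where "f = e \<odot> h x"
      using f by (auto simp: below_def right_ideal_def)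
    then have "right_ideal f \<subseteq> right_ideal e"
      by (auto simp: right_ideal_def assoc hom[symmetric])
    ultimately have "right_ideal f \<subset> right_ideal e"
      using f by (auto simp: below_def)
    moreover have "finite (right_ideal e)"
      using fin by (simp add: right_ideal_def)
    ultimately show False
      using min[OF \<open>f \<in> E\<close>] psubset_card_mono by (metis not_le)
  qed
  then have "\<forall>\<^sub>\<infinity>j. \<not> event s f w j" if "f \<in> below s e" for f
    using that by (auto simp: E_def below_def)
  moreover have "finite (below s e)"
    using fin by (simp add: below_def right_ideal_def)
  ultimately have "accepting_pair s e w"
    using e by (auto simp: accepting_pair_def E_def eventually_ball_finite_distrib)
  then show ?thesis by blast
qed

text \<open>An accepting pair for \<open>w\<close> contributes exactly \<open>f w\<close>:
  \<open>f\<close> takes this value on all words that the pair factorizes, and there is such a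
  word.\<close>

lemma vdra_recognizable_if_saturated:
  fixes f :: "'a word \<Rightarrow> 'l::complete_lattice"
  assumes sat: "\<And>s e w w'. \<lbrakk>factorizes s e w; factorizes s e w'\<rbrakk> \<Longrightarrow> f w = f w'"
  shows "vdra_recognizable f"
proof -
  have pair: "f w' = f w" if acc: "accepting_pair s e w" and w': "factorizes s e w'" for s e w w'
  proof -
    obtain e' u where u: "factorizes s e' w" "factorizes s e' u" "factorizes s e u"
      by (rule accepting_pair_equivalent[OF acc]) (rule that)
    show ?thesis
      using sat[OF u(1,2)] sat[OF u(3) w'] by simp
  qed
  have "vdra_language (subset_automaton f) w = f w" for w
  proof (rule antisym)
    show "vdra_language (subset_automaton f) w \<le> f w"
      unfolding vdra_language_def
    proof (rule Sup_least, elim CollectE exE conjE)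
      fix v H K n
      assume v: "v = ra_accept (subset_automaton f) H K"
        and run: "\<forall>m\<ge>n. vdra_run (subset_automaton f) w m \<notin> H"
          "\<forall>n. \<exists>m\<ge>n. vdra_run (subset_automaton f) w m \<in> K"
      \<comment> \<open>Different linked pairs may yield the same \<open>H\<close> and
        \<open>K\<close>; each of them is accepting for \<open>w\<close>, so all joined values
        agree.\<close>
      have "f w' \<le> f w"
        if "linked s e" "factorizes s e w'" "H = avoid s e" "K = recur s e" for s e w'
      proof -
        have "accepting_pair s e w"
          unfolding accepting_pair_run[of s e w f] using run that by blast
        then show ?thesis using pair that(2) by simp
      qed
      then show "v \<le> f w"
        unfolding v by (auto simp: subset_automaton_def intro!: Sup_least)
    qed
    obtain s e where acc: "accepting_pair s e w"
      using accepting_pair_exists by blast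
    obtain w' where w': "factorizes s e w'"
      by (rule accepting_pair_equivalent[OF acc]) (rule that)
    have "f w = f w'" using pair[OF acc w'] by simp
    also have "\<dots> \<le> ra_accept (subset_automaton f) (avoid s e) (recur s e)"
      using w' acc unfolding subset_automaton_def vdra.simps
      by (intro Sup_upper) (auto simp: accepting_pair_def)
    also have "\<dots> \<le> vdra_language (subset_automaton f) w"
      unfolding vdra_language_def
    proof (rule Sup_upper)
      have "avoid s e \<subseteq> ra_states (subset_automaton f)" "recur s e \<subseteq> ra_states (subset_automaton f)"
        by (simp_all add: subset_automaton_def avoid_def recur_def)
      with acc[unfolded accepting_pair_run[of s e w f]]
      show "ra_accept (subset_automaton f) (avoid s e) (recur s e) \<in>
        {ra_accept (subset_automaton f) H K | H K.
          H \<subseteq> ra_states (subset_automaton f) \<and> K \<subseteq> ra_states (subset_automaton f) \<and>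
          (\<exists>n. \<forall>m\<ge>n. vdra_run (subset_automaton f) w m \<notin> H) \<and>
          (\<forall>n. \<exists>m\<ge>n. vdra_run (subset_automaton f) w m \<in> K)}"
        by blast
    qed
    finally show "f w \<le> vdra_language (subset_automaton f) w" .
  qed
  then have "vdra_language (subset_automaton f) = f" by (rule ext)
  then show ?thesis
    using vdra_recognizable_any_state_type[OF is_vdra_subset_automaton, of f] by simp
qed

end

section \<open>Transition profiles of a Buchi automaton\<close>

text \<open>The set of transitions used suffices, without order or multiplicity, because meets are
  idempotent and commutative.\<close>

primrec profile :: "'q set \<Rightarrow> 'a list \<Rightarrow> ('q \<times> ('q \<times> 'a \<times> 'q) set \<times> 'q) set" where
  "profile Q [] = {(p, {}, p) | p. p \<in> Q}"
| "profile Q (a # u) =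
     {(p, insert (p, a, q) D, r) | p q D r. p \<in> Q \<and> (q, D, r) \<in> profile Q u}"

definition profile_comp ::
  "('q \<times> 'b set \<times> 'q) set \<Rightarrow> ('q \<times> 'b set \<times> 'q) set \<Rightarrow> ('q \<times> 'b set \<times> 'q) set" where
  "profile_comp X Y = {(p, D \<union> E, r) | p D q E r. (p, D, q) \<in> X \<and> (q, E, r) \<in> Y}"

definition triples :: "(nat \<Rightarrow> 'q) \<Rightarrow> 'a word \<Rightarrow> nat \<Rightarrow> nat \<Rightarrow> ('q \<times> 'a \<times> 'q) set" where
  "triples q w i j = (\<lambda>k. (q k, w k, q (Suc k))) ` {i..<j}"

lemma profile_subset: "profile Q u \<subseteq> Q \<times> Pow (Q \<times> UNIV \<times> Q) \<times> Q"
  by (induction u) fastforce+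

lemma profile_comp_assoc:
  "profile_comp (profile_comp X Y) Z = profile_comp X (profile_comp Y Z)"
  unfolding profile_comp_def by (auto simp: Un_assoc) (metis Un_assoc)+

lemma profile_append: "profile Q (u @ v) = profile_comp (profile Q u) (profile Q v)"
proof (induction u)
  case Nil
  show ?case
    using profile_subset[of Q v] by (auto simp: profile_comp_def)
next
  case (Cons a u)
  have "profile Q ((a # u) @ v) =
    {(p, insert (p, a, q) (D \<union> E), r) | p q D q' E r.
       p \<in> Q \<and> (q, D, q') \<in> profile Q u \<and> (q', E, r) \<in> profile Q v}"
    by (auto simp: Cons profile_comp_def) metis+
  also have "\<dots> = profile_comp (profile Q (a # u)) (profile Q v)"
    by (auto simp: profile_comp_def) (blast, metis)
  finally show ?case .
qed

lemma finite_range_profile: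
  fixes Q :: "'q set"
  assumes "finite Q"
  shows "finite (range (profile Q :: ('a::finite) list \<Rightarrow> _))"
proof (rule finite_subset)
  show "range (profile Q :: 'a list \<Rightarrow> _) \<subseteq> Pow (Q \<times> Pow (Q \<times> UNIV \<times> Q) \<times> Q)"
    using profile_subset by blast
  show "finite (Pow (Q \<times> Pow (Q \<times> (UNIV :: 'a set) \<times> Q) \<times> Q))"
    using assms by simp
qed

lemma triples_Suc: "i \<le> j \<Longrightarrow> triples q w i (Suc j) = triples q w i j \<union> {(q j, w j, q (Suc j))}"
  by (simp add: triples_def atLeastLessThanSuc)

lemma run_in_profile:
  assumes "\<And>k. q k \<in> Q" "i \<le> j"
  shows "(q i, triples q w i j, q j) \<in> profile Q (w [i \<rightarrow> j])"
  using assms(2)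
proof (induction j rule: dec_induct)
  case base
  then show ?case using assms(1) by (simp add: triples_def)
next
  case (step j)
  have "(q j, {(q j, w j, q (Suc j))}, q (Suc j)) \<in> profile Q [w j]"
    using assms(1) by simp
  with step show ?case
    by (simp add: profile_append profile_comp_def triples_Suc del: profile.simps) blast
qed

lemma profile_run:
  assumes "(p, D, r) \<in> profile Q (w [i \<rightarrow> j])" "i \<le> j"
  shows "\<exists>c. c i = p \<and> c j = r \<and> (\<forall>k. c k \<in> Q) \<and> D = triples c w i j"
  using assms(2,1)
proof (induction j arbitrary: D r rule: dec_induct)
  case base
  then show ?case by (intro exI[of _ "\<lambda>_. p"]) (simp add: triples_def)
next
  case (step j)
  then obtain D' q where D': "(p, D', q) \<in> profile Q (w [i \<rightarrow> j])" "r \<in> Q" "q \<in> Q"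
    and D: "D = D' \<union> {(q, w j, r)}"
    by (auto simp: profile_append profile_comp_def)
  obtain c where c: "c i = p" "c j = q" "\<And>k. c k \<in> Q" "D' = triples c w i j"
    using step.IH[OF D'(1)] by blast
  let ?c = "c(Suc j := r)"
  have eq: "D = triples ?c w i (Suc j)"
    using step.hyps c(2,4) D by (simp add: triples_Suc) (simp add: triples_def)
  show ?case
  proof (intro exI[of _ ?c] conjI allI)
    show "?c i = p" "?c (Suc j) = r" "?c k \<in> Q" for k
      using c(1,3) D'(2) step.hyps by simp_all
  qed (rule eq)
qed

text \<open>Equal profiles reproduce each block of the run on the matching block of
  \<open>w'\<close> with the same endpoints, so the pieces can be merged.\<close>

lemma glue_runs:
  assumes G: "idx_sequence G" and G': "idx_sequence G'"
    and eq: "\<And>n. profile Q (w [G n \<rightarrow> G (Suc n)]) = profile Q (w' [G' n \<rightarrow> G' (Suc n)])"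
    and q: "\<And>k. q k \<in> Q"
  obtains q' where "\<And>k. q' k \<in> Q" "q' 0 = q 0"
    "\<And>n. triples q' w' (G' n) (G' (Suc n)) = triples q w (G n) (G (Suc n))"
proof -
  have less: "G n < G (Suc n)" "G' n < G' (Suc n)" "G 0 = 0" "G' 0 = 0" for n
    using G G' by (simp_all add: idx_sequence_def)
  have "\<exists>c. c (G' n) = q (G n) \<and> c (G' (Suc n)) = q (G (Suc n)) \<and> (\<forall>k. c k \<in> Q) \<and>
      triples q w (G n) (G (Suc n)) = triples c w' (G' n) (G' (Suc n))" for n
    using less(1,2) run_in_profile[of q Q "G n" "G (Suc n)" w, OF q] unfolding eq
    by (intro profile_run) (simp_all add: less_imp_le)
  then obtain c where c: "\<And>n. c n (G' n) = q (G n)" "\<And>n. c n (G' (Suc n)) = q (G (Suc n))"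
    "\<And>n k. c n k \<in> Q"
    "\<And>n. triples q w (G n) (G (Suc n)) = triples (c n) w' (G' n) (G' (Suc n))"
    by metis
  let ?q = "merge c G'"
  have block: "?q k = c n k" if "G' n \<le> k" "k \<le> G' (Suc n)" for n k
  proof (cases "k = G' (Suc n)")
    \<comment> \<open>Under \<open>merge\<close> a cut belongs to the next piece; both pieces take
      the value \<open>q (G (Suc n))\<close> there.\<close>
    case True
    then have "?q k = c (Suc n) k"
      using less(2) by (intro merge[OF G']) simp
    then show ?thesis using True c(1,2) by simp
  next
    case False
    then show ?thesis using that by (intro merge[OF G']) simp
  qed
  have "?q k \<in> Q" for k
    using idx_sequence_interval[OF G', of k] block c(3) by (metis atLeastLessThan_iff less_imp_le)
  moreover have "?q 0 = q 0"
    using merge0[OF G', of c] c(1)[of 0] less(3,4) by simp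
  moreover have "triples ?q w' (G' n) (G' (Suc n)) = triples q w (G n) (G (Suc n))" for n
    unfolding c(4) unfolding triples_def using block by (intro image_cong) auto
  ultimately show ?thesis by (rule that)
qed

definition run_value ::
  "('q, 'a, 'l::complete_lattice) vba \<Rightarrow> 'a word \<Rightarrow> (nat \<Rightarrow> 'q) \<Rightarrow> nat set \<Rightarrow> 'l" where
  "run_value B w q J = ba_initial B (q 0)
     \<sqinter> (INF i. ba_trans B (q i) (w i) (q (Suc i))) \<sqinter> (INF j\<in>J. ba_final B (q j))"

lemma run_value_le_language:
  assumes "\<And>i. q i \<in> ba_states B" "infinite J"
  shows "run_value B w q J \<le> vba_language B w"
  unfolding vba_language_def run_value_def using assms by (intro Sup_upper) blast

lemma vba_language_le:
  assumes "\<And>q J. \<lbrakk>\<And>i. q i \<in> ba_states B; infinite J\<rbrakk> \<Longrightarrow> run_value B w q J \<le> v"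
  shows "vba_language B w \<le> v"
  unfolding vba_language_def using assms unfolding run_value_def by (intro Sup_least) blast

lemma vba_language_le_same_profile:
  assumes B: "is_vba B"
    and G: "idx_sequence G" and G': "idx_sequence G'"
    and eq: "\<And>n. profile (ba_states B) (w [G n \<rightarrow> G (Suc n)]) =
                   profile (ba_states B) (w' [G' n \<rightarrow> G' (Suc n)])"
  shows "vba_language B w \<le> vba_language B w'"
proof (rule vba_language_le)
  fix q :: "nat \<Rightarrow> _" and J :: "nat set"
  assume q: "\<And>i. q i \<in> ba_states B" and J: "infinite J"
  obtain q' where q': "\<And>k. q' k \<in> ba_states B" "q' 0 = q 0"
    and tr: "\<And>n. triples q' w' (G' n) (G' (Suc n)) = triples q w (G n) (G (Suc n))"
    by (rule glue_runs[OF G G' eq q])  (rule that)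
  \<comment> \<open>One state recurring along \<open>J\<close> is enough: the meet over
    \<open>J\<close> is below its final value, so \<open>J'\<close> may collect all visits of
    \<open>q'\<close> to it.\<close>
  have "finite (q ` J)"
    using B q by (auto simp: is_vba_def intro: finite_subset)
  then obtain j0 where j0: "j0 \<in> J" "infinite {j \<in> J. q j = q j0}"
    using pigeonhole_infinite[OF J] by blast
  define J' where "J' = {j. q' j = q j0}"
  have "infinite J'"
    unfolding infinite_nat_iff_unbounded_le
  proof
    fix m
    have G'_ge: "m \<le> G' m"
      using strict_mono_imp_increasing[of G'] G' by (simp add: idx_sequence_def strict_mono_Suc_iff)
    obtain j where j: "G m \<le> j" "q j = q j0"
      using j0(2) unfolding infinite_nat_iff_unbounded_le by blast
    obtain n where n: "j \<in> {G n..<G (Suc n)}"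
      using idx_sequence_interval[OF G] by blast
    then have "m \<le> n"
      using j(1) idx_sequence_mono[OF G, of "Suc n" m] by (meson atLeastLessThan_iff le_trans not_less not_less_eq_eq)
    \<comment> \<open>The visit appears as a source state in the transition set of block
      \<open>n\<close>, which \<open>q'\<close> shares.\<close>
    have "(q j, w j, q (Suc j)) \<in> triples q' w' (G' n) (G' (Suc n))"
      using n unfolding tr unfolding triples_def by blast
    then obtain k where "G' n \<le> k" "q' k = q j"
      by (auto simp: triples_def)
    moreover have "m \<le> G' n"
      using idx_sequence_mono[OF G' \<open>m \<le> n\<close>] G'_ge by simp
    ultimately show "\<exists>k\<ge>m. k \<in> J'"
      using j(2) unfolding J'_def by (intro exI[of _ k]) simp
  qed
  have "run_value B w q J \<le> run_value B w' q' J'"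
    unfolding run_value_def
  proof (intro inf_mono)
    show "ba_initial B (q 0) \<le> ba_initial B (q' 0)" using q' by simp
    show "(INF i. ba_trans B (q i) (w i) (q (Suc i))) \<le> (INF i. ba_trans B (q' i) (w' i) (q' (Suc i)))"
    proof (rule INF_mono)
      fix i
      obtain n where "i \<in> {G' n..<G' (Suc n)}"
        using idx_sequence_interval[OF G'] by blast
      then have "(q' i, w' i, q' (Suc i)) \<in> triples q w (G n) (G (Suc n))"
        unfolding tr[symmetric] unfolding triples_def by blast
      then show "\<exists>k\<in>UNIV. ba_trans B (q k) (w k) (q (Suc k)) \<le> ba_trans B (q' i) (w' i) (q' (Suc i))"
        by (auto simp: triples_def)
    qed
    show "(INF j\<in>J. ba_final B (q j)) \<le> (INF j\<in>J'. ba_final B (q' j))"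
      using j0(1) by (auto simp: J'_def intro!: INF_greatest INF_lower)
  qed
  also have "\<dots> \<le> vba_language B w'"
    using q'(1) \<open>infinite J'\<close> by (rule run_value_le_language)
  finally show "run_value B w q J \<le> vba_language B w'" .
qed

lemma vdra_recognizable_vba_language:
  fixes B :: "('q, 'a::finite, 'l::complete_lattice) vba"
  assumes B: "is_vba B"
  shows "vdra_recognizable (vba_language B)"
proof -
  let ?h = "profile (ba_states B) :: 'a list \<Rightarrow> _"
  interpret finite_word_hom profile_comp ?h
    using B by unfold_locales (simp_all add: profile_comp_assoc profile_append is_vba_def finite_range_profile)
  have le: "vba_language B w \<le> vba_language B w'"
    if fac: "factorizes s e w" "factorizes s e w'" for s e w w'
  proof -
    obtain G where G: "idx_sequence G" "?h (w [G 0 \<rightarrow> G 1]) = s"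
      "\<And>n. ?h (w [G (Suc n) \<rightarrow> G (Suc (Suc n))]) = e"
      using fac(1) unfolding factorizes_def by blast
    obtain G' where G': "idx_sequence G'" "?h (w' [G' 0 \<rightarrow> G' 1]) = s"
      "\<And>n. ?h (w' [G' (Suc n) \<rightarrow> G' (Suc (Suc n))]) = e"
      using fac(2) unfolding factorizes_def by blast
    have "?h (w [G n \<rightarrow> G (Suc n)]) = ?h (w' [G' n \<rightarrow> G' (Suc n)])" for n
      using G(2,3) G'(2,3) by (cases n) simp_all
    with B G(1) G'(1) show ?thesis
      by (rule vba_language_le_same_profile)
  qed
  show ?thesis
    by (rule vdra_recognizable_if_saturated) (blast intro: antisym le)
qed

section \<open>From Rabin to Buchi automata\<close>

text \<open>\<open>None\<close> means that no pair has been guessed yet. A guess is never revised,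
  and from the guessing transition on every target state is tested against \<open>H\<close>.\<close>

fun guess_trans :: "('q, 'a, 'l) vdra \<Rightarrow> 'q \<times> ('q set \<times> 'q set) option \<Rightarrow> 'a
    \<Rightarrow> 'q \<times> ('q set \<times> 'q set) option \<Rightarrow> bool" where
  "guess_trans A (p, x) a (p', x') \<longleftrightarrow> p' = ra_trans A p a \<and> (x = None \<or> x' = x) \<and>
     (case x' of None \<Rightarrow> True | Some (H, K) \<Rightarrow> p' \<notin> H)"

fun guess_final :: "('q, 'a, 'l::complete_lattice) vdra \<Rightarrow> 'q \<times> ('q set \<times> 'q set) option \<Rightarrow> 'l" where
  "guess_final A (p, None) = bot"
| "guess_final A (p, Some (H, K)) = (if p \<in> K then ra_accept A H K else bot)"

definition guess_automaton ::
  "('q, 'a, 'l::complete_lattice) vdra \<Rightarrow> ('q \<times> ('q set \<times> 'q set) option, 'a, 'l) vba" where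
  "guess_automaton A = \<lparr>
     ba_states = ra_states A \<times> insert None (Some ` (Pow (ra_states A) \<times> Pow (ra_states A))),
     ba_trans = (\<lambda>p a r. if guess_trans A p a r then top else bot),
     ba_initial = (\<lambda>p. if p = (ra_start A, None) then top else bot),
     ba_final = guess_final A\<rparr>"

lemma guess_automaton_language_le:
  "vba_language (guess_automaton A) w \<le> vdra_language A w"
proof (rule vba_language_le)
  fix q :: "nat \<Rightarrow> _" and J :: "nat set"
  assume q: "\<And>i. q i \<in> ba_states (guess_automaton A)" and J: "infinite J"
  let ?v = "run_value (guess_automaton A) w q J"
  show "?v \<le> vdra_language A w"
  \<comment> \<open>Initial and transition values are only \<open>top\<close> or \<open>bot\<close>,
    so a value other than \<open>bot\<close> forces a genuine run.\<close>
  proof (cases "?v = bot")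
    case False
    have init: "q 0 = (ra_start A, None)"
      by (rule ccontr) (use False in \<open>simp add: run_value_def guess_automaton_def\<close>)
    have step: "guess_trans A (q i) (w i) (q (Suc i))" for i
    proof (rule ccontr)
      assume "\<not> ?thesis"
      then have "(INF i. ba_trans (guess_automaton A) (q i) (w i) (q (Suc i))) \<le> bot"
        by (intro INF_lower2[of i]) (simp_all add: guess_automaton_def)
      then have "(INF i. ba_trans (guess_automaton A) (q i) (w i) (q (Suc i))) = bot"
        by (rule bot_unique[THEN iffD1])
      then show False
        using False by (simp add: run_value_def)
    qed
    have v_le: "?v \<le> guess_final A (q j)" if "j \<in> J" for j
    proof -
      have "?v \<le> (INF j\<in>J. guess_final A (q j))"
        by (simp add: run_value_def guess_automaton_def)
      also have "\<dots> \<le> guess_final A (q j)" using that by (rule INF_lower)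
      finally show ?thesis .
    qed
    have final: "guess_final A (q j) \<noteq> bot" if "j \<in> J" for j
      using v_le[OF that] False by (metis bot_unique)
    have run: "fst (q i) = vdra_run A w i" for i
    proof (induction i)
      case (Suc i)
      then show ?case using step[of i] by (cases "q i"; cases "q (Suc i)") simp
    qed (simp add: init)
    obtain n where n: "n \<in> J" using J by fastforce
    obtain H K where HK: "snd (q n) = Some (H, K)"
      using final[OF n] by (cases "q n"; cases "snd (q n)") auto
    have stay: "snd (q m) = Some (H, K)" if "n \<le> m" for m
      using that
    proof (induction m rule: dec_induct)
      case (step m)
      then show ?case
        using \<open>guess_trans A (q m) (w m) (q (Suc m))\<close> by (cases "q m"; cases "q (Suc m)") simp
    qed (rule HK)
    have "vdra_run A w m \<notin> H" if "m \<ge> Suc n" for m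
    proof -
      obtain k where k: "m = Suc k" "n \<le> k" using \<open>m \<ge> Suc n\<close> by (cases m) auto
      then show ?thesis
        using step[of k] stay[of m] run[of m] by (cases "q k"; cases "q (Suc k)") simp
    qed
    moreover have in_K: "vdra_run A w j \<in> K \<and> guess_final A (q j) = ra_accept A H K"
      if "j \<in> J" "n \<le> j" for j
      using final[OF that(1)] stay[OF that(2)] run[of j]
      by (cases "q j") (auto split: if_splits)
    have "\<exists>m\<ge>k. vdra_run A w m \<in> K" for k
    proof -
      obtain j where "j \<in> J" "max n k \<le> j"
        using J unfolding infinite_nat_iff_unbounded_le by blast
      then show ?thesis using in_K by auto
    qed
    moreover have "H \<subseteq> ra_states A" "K \<subseteq> ra_states A"
      using q[of n] HK by (auto simp: guess_automaton_def)
    ultimately have "ra_accept A H K \<le> vdra_language A w"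
      unfolding vdra_language_def by (intro Sup_upper) blast
    moreover have "?v \<le> ra_accept A H K"
      using v_le[OF n] in_K[OF n] by simp
    ultimately show ?thesis by (rule order_trans[rotated])
  qed simp
qed

lemma guess_automaton_language_ge:
  assumes A: "is_vdra A"
  shows "vdra_language A w \<le> vba_language (guess_automaton A) w"
  unfolding vdra_language_def
proof (rule Sup_least, elim CollectE exE conjE)
  fix v H K n
  assume v: "v = ra_accept A H K" and sub: "H \<subseteq> ra_states A" "K \<subseteq> ra_states A"
    and H: "\<forall>m\<ge>n. vdra_run A w m \<notin> H" and K: "\<forall>n. \<exists>m\<ge>n. vdra_run A w m \<in> K"
  \<comment> \<open>The guess takes effect at \<open>Suc n\<close>, when \<open>H\<close> is already
    avoided; positions up to \<open>n\<close> have final value \<open>bot\<close> and are left out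
    of \<open>J\<close>.\<close>
  define q where "q i = (vdra_run A w i, if i \<le> n then None else Some (H, K))" for i
  define J where "J = {j. n < j \<and> vdra_run A w j \<in> K}"
  have "infinite J"
    unfolding infinite_nat_iff_unbounded_le
  proof
    fix m
    obtain j where "max m (Suc n) \<le> j" "vdra_run A w j \<in> K" using K by blast
    then show "\<exists>j\<ge>m. j \<in> J" by (auto simp: J_def)
  qed
  have "vdra_run A w i \<in> ra_states A" for i
    using A by (induction i) (auto simp: is_vdra_def)
  then have "q i \<in> ba_states (guess_automaton A)" for i
    using sub by (auto simp: q_def guess_automaton_def)
  moreover have "v \<le> run_value (guess_automaton A) w q J"
    unfolding run_value_def
  proof (intro inf.boundedI INF_greatest)
    have "guess_trans A (q i) (w i) (q (Suc i))" for i
      using H[rule_format, of "Suc i"] by (auto simp: q_def)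
    then show "v \<le> ba_trans (guess_automaton A) (q i) (w i) (q (Suc i))" for i
      by (simp add: guess_automaton_def)
  qed (simp_all add: guess_automaton_def q_def J_def v)
  ultimately show "v \<le> vba_language (guess_automaton A) w"
    using run_value_le_language[OF _ \<open>infinite J\<close>] order_trans by blast
qed

lemma vba_recognizable_vdra_language:
  assumes "is_vdra A"
  shows "vba_recognizable (vdra_language A)"
proof -
  have "vba_language (guess_automaton A) = vdra_language A"
    by (intro ext antisym guess_automaton_language_le guess_automaton_language_ge assms)
  moreover have "is_vba (guess_automaton A)"
    using assms by (simp add: is_vba_def is_vdra_def guess_automaton_def)
  ultimately show ?thesis
    using vba_recognizable_any_state_type by metis
qed

theorem theorem5:
  fixes f :: "('a::finite) word \<Rightarrow> ('l::{complete_lattice, distrib_lattice})"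
  shows "vdra_recognizable f \<longleftrightarrow> vba_recognizable f"
proof
  assume "vdra_recognizable f"
  then show "vba_recognizable f"
    unfolding vdra_recognizable_def using vba_recognizable_vdra_language by blast
next
  assume "vba_recognizable f"
  then show "vdra_recognizable f"
    unfolding vba_recognizable_def using vdra_recognizable_vba_language by blast
qed

end
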